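(* Consider the multi-level caching setup with $L$ levels, $K$ caches and, for each level $i$, $U_i$ users per cache with access degree $d_i$ and $N_i\ge KU_i$ files, and let $D=\max_i d_i$. For any $M\ge0$, any $A\subseteq\{1,\dots,L\}$, any $l\in\{1,\dots,L\}$ with $l\notin A$, any $s\in\{d_l,\dots,K\}$, and any positive integer $b$, $$R^\ast(M)\ge\frac1{D+1}\min\left\{(s-d_l+1)U_l,\ \frac{N_l}{sb}\right\}+\sum_{j\in A}\min\left\{U_j,\ \frac{N_j}{bd_j}\right\}-\frac Mb.$$
   Context: Setup. All of $L,K,N_i,U_i,d_i$ are positive integers with $d_i\le K$. A server hosts files of $F$ bits each, independent and uniformly distributed; level $i$ has $N_i$ files. There are $K$ caches (access points) arranged cyclically, each storing $MF$ bits, with $M\ge0$ real. For each level $i$ and each $k\in\{1,\dots,K\}$ there are $U_i$ users who access exactly the $d_i$ consecutive caches $k,\dots,k+d_i-1$ (indices cyclic modulo $K$); each such user requests one file of level $i$. In the placement phase the caches are filled as functions of the files, before the requests are known. In the delivery phase, once all requests are known, the server sends one broadcast message (a function of all files and of the requests) heard by all users; each user must recover its requested file from the broadcast and the contents of the caches it accesses. Optimal rate. $(R,M)$ is achievable if for every $\varepsilon>0$ and all sufficiently large $F$ there is a placement strategy in caches of $MF$ bits such that, for every request profile, there is a broadcast of at most $(R+\varepsilon)F$ bits from which all users recover their requested files with error probability at most $\varepsilon$. $R^\ast(M)=\inf\{R\ge0:(R,M)\text{ achievable}\}$, over all possible schemes. *)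

theory Defs
  imports "HOL-Probability.Probability"
begin

text \<open>
  Levels are numbered \<open>1, \<dots>, L\<close>; caches, the files of a level, and the users of a level at a
  given position are numbered from \<open>0\<close>. The file \<open>(i, n)\<close> is the \<open>n\<close>-th file of level \<open>i\<close>. The user
  \<open>(i, k, u)\<close> is the \<open>u\<close>-th of the \<open>U i\<close> level-\<open>i\<close> users accessing the caches
  \<open>k, \<dots>, k + d i - 1\<close> modulo \<open>K\<close>.
\<close>

type_synonym bits = "bool list"
type_synonym library = "nat \<times> nat \<Rightarrow> bits"
type_synonym user = "nat \<times> nat \<times> nat"

definition files :: "nat \<Rightarrow> (nat \<Rightarrow> nat) \<Rightarrow> (nat \<times> nat) set" where
  "files L N = (SIGMA i:{1..L}. {..<N i})"

definition users :: "nat \<Rightarrow> nat \<Rightarrow> (nat \<Rightarrow> nat) \<Rightarrow> user set" where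
  "users L K U = (SIGMA i:{1..L}. {..<K} \<times> {..<U i})"

definition requests :: "nat \<Rightarrow> nat \<Rightarrow> (nat \<Rightarrow> nat) \<Rightarrow> (nat \<Rightarrow> nat) \<Rightarrow> (user \<Rightarrow> nat) set" where
  "requests L K N U = Pi (users L K U) (\<lambda>(i, k, u). {..<N i})"

definition library_pmf :: "nat \<Rightarrow> (nat \<Rightarrow> nat) \<Rightarrow> nat \<Rightarrow> library pmf" where
  "library_pmf L N F = Pi_pmf (files L N) [] (\<lambda>_. pmf_of_set {w. length w = F})"

definition accessed :: "nat \<Rightarrow> (nat \<Rightarrow> nat) \<Rightarrow> (nat \<Rightarrow> bits) \<Rightarrow> user \<Rightarrow> bits list" where
  "accessed K d z = (\<lambda>(i, k, u). map (\<lambda>t. z ((k + t) mod K)) [0..<d i])"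

text \<open>
  \<open>Z k W\<close> is the content of cache \<open>k\<close>, \<open>X W\<close> the broadcast and \<open>\<delta> v\<close> the decoder of user \<open>v\<close>, for a
  fixed request profile \<open>r\<close>. An error occurs as soon as one of the users fails.
\<close>

definition error_prob ::
  "nat \<Rightarrow> nat \<Rightarrow> (nat \<Rightarrow> nat) \<Rightarrow> (nat \<Rightarrow> nat) \<Rightarrow> (nat \<Rightarrow> nat) \<Rightarrow> nat \<Rightarrow>
   (nat \<Rightarrow> library \<Rightarrow> bits) \<Rightarrow> (user \<Rightarrow> nat) \<Rightarrow> (library \<Rightarrow> bits) \<Rightarrow>
   (user \<Rightarrow> bits \<Rightarrow> bits list \<Rightarrow> bits) \<Rightarrow> real" where
  "error_prob L K N U d F Z r X \<delta> =
     measure_pmf.prob (library_pmf L N F)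
       {W. \<exists>v\<in>users L K U. \<delta> v (X W) (accessed K d (\<lambda>k. Z k W) v) \<noteq> W (fst v, r v)}"

text \<open>
  The placement \<open>Z\<close> is chosen before the request profile; the broadcast and the decoders may depend
  on the profile. The sizes \<open>M F\<close> and \<open>(R + \<epsilon>) F\<close> need not be integers, so a cache stores
  \<open>\<lfloor>M F\<rfloor>\<close> bits, and the block length \<open>n\<close> of the broadcast is any natural number
  \<open>n \<le> (R + \<epsilon>) F\<close>.
\<close>

definition achievable ::
  "nat \<Rightarrow> nat \<Rightarrow> (nat \<Rightarrow> nat) \<Rightarrow> (nat \<Rightarrow> nat) \<Rightarrow> (nat \<Rightarrow> nat) \<Rightarrow> real \<Rightarrow> real \<Rightarrow> bool" where
  "achievable L K N U d R M \<longleftrightarrow>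
     (\<forall>\<epsilon>>0. \<forall>\<^sub>F F in sequentially.
        \<exists>Z. (\<forall>k<K. \<forall>W. length (Z k W) = nat \<lfloor>M * real F\<rfloor>) \<and>
            (\<forall>r\<in>requests L K N U. \<exists>n X \<delta>.
               real n \<le> (R + \<epsilon>) * real F \<and> (\<forall>W. length (X W) = n) \<and>
               error_prob L K N U d F Z r X \<delta> \<le> \<epsilon>))"

definition optimal_rate ::
  "nat \<Rightarrow> nat \<Rightarrow> (nat \<Rightarrow> nat) \<Rightarrow> (nat \<Rightarrow> nat) \<Rightarrow> (nat \<Rightarrow> nat) \<Rightarrow> real \<Rightarrow> real" where
  "optimal_rate L K N U d M = Inf {R. 0 \<le> R \<and> achievable L K N U d R M}"

text \<open>
  Broadcasting the whole library is always possible, so the infimum is taken over a nonempty set.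
\<close>

lemma achievable_broadcast_all:
  "achievable L K N U d (real (card (files L N))) M"
  unfolding achievable_def
proof (intro allI impI always_eventually)
  fix \<epsilon> :: real and F :: nat
  assume \<epsilon>: "\<epsilon> > 0"
  define S :: "library set" where "S = PiE_dflt (files L N) [] (\<lambda>_. {w. length w = F})"
  define n where "n = F * card (files L N)"
  have len: "{w::bits. length w = m} = {w. set w \<subseteq> UNIV \<and> length w = m}" for m by simp
  have fl: "finite {w::bits. length w = m}" for m
    unfolding len by (rule finite_lists_length_eq) simp
  have cl: "card {w::bits. length w = m} = 2 ^ m" for m
    unfolding len by (subst card_lists_length_eq) auto
  have ff: "finite (files L N)" by (auto simp: files_def)
  have "card S = 2 ^ n"
    unfolding S_def using ff by (simp add: card_PiE_dflt fl cl n_def power_mult)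
  moreover have "finite S" unfolding S_def using ff fl by (intro finite_PiE_dflt) auto
  moreover have "card {w::bits. length w = n} = 2 ^ n" by (rule cl)
  ultimately obtain g where g: "bij_betw g S {w::bits. length w = n}"
    using finite_same_card_bij[OF _ fl] by force
  define X where "X W = (if W \<in> S then g W else replicate n False)" for W
  define Z :: "nat \<Rightarrow> library \<Rightarrow> bits"
    where "Z = (\<lambda>_ _. replicate (nat \<lfloor>M * real F\<rfloor>) False)"
  have supp: "set_pmf (library_pmf L N F) = S"
  proof -
    have "{w::bits. length w = F} \<noteq> {}" using Ex_list_of_length by auto
    thus ?thesis
      unfolding library_pmf_def S_def by (simp add: set_Pi_pmf ff set_pmf_of_set fl comp_def)
  qed
  have X_len: "length (X W) = n" for W
    using g by (auto simp: X_def bij_betw_def)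
  have n_le: "real n \<le> (real (card (files L N)) + \<epsilon>) * real F"
    using \<epsilon> by (simp add: n_def algebra_simps)
  have err: "error_prob L K N U d F Z r X (\<lambda>v x c. inv_into S g x (fst v, r v)) = 0" for r
  proof -
    have "inv_into S g (X W) = W" if "W \<in> S" for W
      using that g by (auto simp: X_def bij_betw_def)
    thus ?thesis
      unfolding error_prob_def by (subst measure_pmf_zero_iff) (auto simp: supp)
  qed
  show "\<exists>Z. (\<forall>k<K. \<forall>W. length (Z k W) = nat \<lfloor>M * real F\<rfloor>) \<and>
          (\<forall>r\<in>requests L K N U. \<exists>n X \<delta>.
             real n \<le> (real (card (files L N)) + \<epsilon>) * real F \<and> (\<forall>W. length (X W) = n) \<and>
             error_prob L K N U d F Z r X \<delta> \<le> \<epsilon>)"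
  proof (intro exI[of _ Z] conjI ballI)
    show "\<forall>k<K. \<forall>W. length (Z k W) = nat \<lfloor>M * real F\<rfloor>" by (simp add: Z_def)
  next
    fix r
    show "\<exists>n X \<delta>. real n \<le> (real (card (files L N)) + \<epsilon>) * real F \<and> (\<forall>W. length (X W) = n) \<and>
            error_prob L K N U d F Z r X \<delta> \<le> \<epsilon>"
      using n_le X_len err[of r] \<epsilon>
      by (intro exI[of _ n] exI[of _ X] exI[of _ "\<lambda>v x c. inv_into S g x (fst v, r v)"]) simp
  qed
qed

end

theory Submission
  imports Defs
begin

text \<open>
  Put \<open>J = A \<union> {l}\<close>, \<open>t l = s\<close> and \<open>t j = d j\<close> for \<open>j \<in> A\<close>. For every cache \<open>k\<close> take \<open>b\<close> broadcasts, and
  let \<open>Y k\<close> consist of the content of cache \<open>k\<close> and these broadcasts, so that its entropy is at most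
  \<open>(M + b R) F\<close>. By submodularity, the entropy of \<open>t\<close> cyclically consecutive \<open>Y k\<close>, conditioned on the
  files of some levels and averaged over the position of the window, is concave in \<open>t\<close>; hence its
  quotient by \<open>t\<close> is nonincreasing. Starting from \<open>t = 1\<close>, visit the levels \<open>j \<in> J\<close> by increasing
  \<open>t j\<close>: at \<open>t = t j\<close> split off the files of level \<open>j\<close> that the window decodes, and condition on level
  \<open>j\<close> before going on.

  It remains to choose the requests so that the windows decode many distinct files. For \<open>j \<in> A\<close> a
  window determines a single user position, the windows do not interfere, and
  \<open>min (b (d j) (U j)) (N j)\<close> files are decoded. For level \<open>l\<close>, uniformly random requests lose at most
  a factor of two, and \<open>1 / (D + 1) \<le> 1 / 2\<close>.

  Decoding errors need no Fano inequality: all entropies refer to the uniform distribution on the set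
  \<open>G\<close> of libraries on which every user succeeds for all broadcasts. This is at least half of all
  libraries, so the total entropy drops by at most one bit.
\<close>

section \<open>Entropy under the uniform distribution on a finite set\<close>

definition cell :: "'a set \<Rightarrow> ('i \<Rightarrow> 'a \<Rightarrow> 'v) \<Rightarrow> 'i set \<Rightarrow> 'a \<Rightarrow> 'a set" where
  "cell G g A x = {y\<in>G. \<forall>i\<in>A. g i y = g i x}"

text \<open>Shannon entropy in bits of the tuple of all \<open>g i\<close>,
  \<open>i \<in> A\<close>, at a uniform point of \<open>G\<close>. Averaging over points works
  because the tuple seen at \<open>x\<close> has probability
  \<open>card (cell G g A x) / card G\<close>.\<close>

definition joint_entropy :: "'a set \<Rightarrow> ('i \<Rightarrow> 'a \<Rightarrow> 'v) \<Rightarrow> 'i set \<Rightarrow> real" where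
  "joint_entropy G g A = (\<Sum>x\<in>G. log 2 (card G / card (cell G g A x))) / card G"

locale uniform_source =
  fixes G :: "'a set" and g :: "'i \<Rightarrow> 'a \<Rightarrow> 'v"
  assumes finite_G: "finite G" and G_ne: "G \<noteq> {}"
begin

abbreviation "H \<equiv> joint_entropy G g"
abbreviation "cl \<equiv> cell G g"

lemma card_G_pos: "card G > 0"
  using finite_G G_ne by (simp add: card_gt_0_iff)

lemma finite_cell [simp]: "finite (cl A x)"
  using finite_G by (simp add: cell_def)

lemma self_in_cell: "x \<in> G \<Longrightarrow> x \<in> cl A x"
  by (simp add: cell_def)

lemma card_cell_pos: "x \<in> G \<Longrightarrow> card (cl A x) > 0"
  using self_in_cell finite_cell by (metis card_gt_0_iff empty_iff)

lemma cell_cong: "y \<in> cl A x \<Longrightarrow> cl A y = cl A x"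
  by (auto simp: cell_def)

lemma joint_entropy_empty: "H {} = 0"
  using card_G_pos by (simp add: joint_entropy_def cell_def)

text \<open>Jensen's inequality in the form \<open>ln q \<le> q - 1\<close>. Submodularity and the
  bound for a single observation both reduce to it.\<close>

lemma sum_log_le:
  fixes q :: "_ \<Rightarrow> real"
  assumes "\<And>x. x \<in> G \<Longrightarrow> q x > 0" and "(\<Sum>x\<in>G. q x) \<le> card G"
  shows "(\<Sum>x\<in>G. log 2 (q x)) \<le> (0::real)"
proof -
  have "(\<Sum>x\<in>G. ln (q x)) \<le> (\<Sum>x\<in>G. q x - 1)"
    using assms(1) by (intro sum_mono ln_le_minus_one) auto
  also have "\<dots> \<le> 0" using assms(2) by (simp add: sum_subtractf)
  finally have "(\<Sum>x\<in>G. ln (q x)) \<le> 0" .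
  then show ?thesis
    by (simp add: log_def divide_le_0_iff flip: sum_divide_distrib)
qed

lemma sum_cell_inverse_le:
  assumes "\<And>x. x \<in> P \<Longrightarrow> P = cl A x"
  shows "(\<Sum>x\<in>P. 1 / real (card (cl A x))) \<le> 1"
proof (cases "P = {}")
  case False
  have "(\<Sum>x\<in>P. 1 / real (card (cl A x))) = (\<Sum>x\<in>P. 1 / real (card P))"
    using assms by (intro sum.cong) auto
  then show ?thesis by simp
qed simp

text \<open>
  By \<open>ln x \<le> x - 1\<close> this gives submodularity. Writing the numerator as a number of pairs \<open>(y, z)\<close>, the
  points \<open>x\<close> that belong to a given pair form a single cell of \<open>A \<union> B\<close> or the empty set.
\<close>

lemma sum_cell_ratio_le:
  "(\<Sum>x\<in>G. real (card (cl A x)) * card (cl B x) /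
      (real (card (cl (A \<union> B) x)) * card (cl (A \<inter> B) x))) \<le> card G"
proof -
  let ?u = "\<lambda>x. 1 / real (card (cl (A \<union> B) x))"
  let ?v = "\<lambda>x. 1 / real (card (cl (A \<inter> B) x))"
  let ?I = "\<lambda>y z x. if y \<in> cl A x \<and> z \<in> cl B x then ?u x * ?v x else 0"
  have "real (card (cl A x)) * card (cl B x) * (?u x * ?v x) = (\<Sum>y\<in>G. \<Sum>z\<in>G. ?I y z x)" for x
  proof -
    have "(\<Sum>y\<in>G. \<Sum>z\<in>G. ?I y z x) =
        (\<Sum>p\<in>G\<times>G. if p \<in> cl A x \<times> cl B x then ?u x * ?v x else 0)"
      by (simp add: sum.cartesian_product case_prod_beta mem_Times_iff)
    also have "\<dots> = (\<Sum>p\<in>(G \<times> G) \<inter> (cl A x \<times> cl B x). ?u x * ?v x)"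
      using finite_G by (intro sum.inter_restrict[symmetric]) simp
    also have "(G \<times> G) \<inter> (cl A x \<times> cl B x) = cl A x \<times> cl B x"
      by (auto simp: cell_def)
    finally show ?thesis by (simp add: card_cartesian_product)
  qed
  then have "(\<Sum>x\<in>G. real (card (cl A x)) * card (cl B x) * (?u x * ?v x)) =
      (\<Sum>x\<in>G. \<Sum>y\<in>G. \<Sum>z\<in>G. ?I y z x)" by simp
  also have "\<dots> = (\<Sum>y\<in>G. \<Sum>x\<in>G. \<Sum>z\<in>G. ?I y z x)" by (rule sum.swap)
  also have "\<dots> = (\<Sum>y\<in>G. \<Sum>z\<in>G. \<Sum>x\<in>G. ?I y z x)"
    by (intro sum.cong refl sum.swap)
  also have "\<dots> \<le> (\<Sum>y\<in>G. \<Sum>z\<in>G. if z \<in> cl (A \<inter> B) y then ?v y else 0)"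
  proof (intro sum_mono)
    fix y z assume yz: "y \<in> G" "z \<in> G"
    let ?P = "{x\<in>G. y \<in> cl A x \<and> z \<in> cl B x}"
    \<comment> \<open>If \<open>y\<close> lies in the \<open>A\<close>-cell of \<open>x\<close>,
      both have the same cell for \<open>A \<inter> B\<close>. So \<open>?v x\<close> depends on
      \<open>y\<close> only and can be pulled out of the sum over \<open>x\<close>.\<close>
    have v: "?v x = ?v y \<and> z \<in> cl (A \<inter> B) y" if "x \<in> ?P" for x
    proof -
      have "y \<in> cl (A \<inter> B) x" "z \<in> cl (A \<inter> B) y" using that by (auto simp: cell_def)
      then show ?thesis using cell_cong by metis
    qed
    have "?P = cl (A \<union> B) x" if "x \<in> ?P" for x
      using that by (auto simp: cell_def)
    then have u: "(\<Sum>x\<in>?P. ?u x) \<le> 1" by (rule sum_cell_inverse_le)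
    have "(\<Sum>x\<in>G. ?I y z x) = (\<Sum>x\<in>?P. ?u x * ?v x)"
      using finite_G by (subst sum.If_cases) (auto intro!: sum.cong)
    also have "\<dots> = (\<Sum>x\<in>?P. ?u x) * ?v y"
      unfolding sum_distrib_right using v by (intro sum.cong) auto
    also have "\<dots> \<le> (if z \<in> cl (A \<inter> B) y then ?v y else 0)"
    proof (cases "z \<in> cl (A \<inter> B) y")
      case True
      then show ?thesis using mult_right_mono[OF u, of "?v y"] by simp
    next
      case False
      then have "?P = {}" using v by blast
      then show ?thesis using False by (simp only: sum.empty) simp
    qed
    finally show "(\<Sum>x\<in>G. ?I y z x) \<le> (if z \<in> cl (A \<inter> B) y then ?v y else 0)" .
  qed
  also have "\<dots> = (\<Sum>y\<in>G. 1)"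
  proof (intro sum.cong refl)
    fix y assume y: "y \<in> G"
    have "(\<Sum>z\<in>G. if z \<in> cl (A \<inter> B) y then ?v y else 0) = (\<Sum>z\<in>G \<inter> cl (A \<inter> B) y. ?v y)"
      using finite_G by (rule sum.inter_restrict[symmetric])
    also have "G \<inter> cl (A \<inter> B) y = cl (A \<inter> B) y" by (auto simp: cell_def)
    finally have "(\<Sum>z\<in>G. if z \<in> cl (A \<inter> B) y then ?v y else 0) = (\<Sum>z\<in>cl (A \<inter> B) y. ?v y)" .
    then show "(\<Sum>z\<in>G. if z \<in> cl (A \<inter> B) y then ?v y else 0) = 1"
      using self_in_cell[OF y, of "A \<inter> B"] by auto
  qed
  finally show ?thesis by simp
qed

lemma joint_entropy_submodular: "H (A \<union> B) + H (A \<inter> B) \<le> H A + H B"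
proof -
  let ?q = "\<lambda>x. real (card (cl A x)) * card (cl B x) /
      (real (card (cl (A \<union> B) x)) * card (cl (A \<inter> B) x))"
  have "(\<Sum>x\<in>G. log 2 (?q x)) \<le> 0"
    by (rule sum_log_le[OF _ sum_cell_ratio_le]) (simp add: card_cell_pos)
  moreover have "log 2 (?q x) =
      log 2 (card G / card (cl (A \<union> B) x)) + log 2 (card G / card (cl (A \<inter> B) x)) -
      log 2 (card G / card (cl A x)) - log 2 (card G / card (cl B x))" if "x \<in> G" for x
  proof -
    have "log 2 (a * b / (c * e)) = log 2 (n / c) + log 2 (n / e) - log 2 (n / a) - log 2 (n / b)"
      if "a > 0" "b > 0" "c > 0" "e > 0" "n > 0" for a b c e n :: real
      using that by (simp add: log_divide_pos log_mult_pos)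
    then show ?thesis using card_G_pos card_cell_pos[OF that] of_nat_0_less_iff by blast
  qed
  ultimately have "(\<Sum>x\<in>G. log 2 (card G / card (cl (A \<union> B) x))) +
      (\<Sum>x\<in>G. log 2 (card G / card (cl (A \<inter> B) x))) \<le>
      (\<Sum>x\<in>G. log 2 (card G / card (cl A x))) + (\<Sum>x\<in>G. log 2 (card G / card (cl B x)))"
    by (simp add: sum_subtractf sum.distrib)
  then show ?thesis
    unfolding joint_entropy_def by (simp add: divide_right_mono flip: add_divide_distrib)
qed

text \<open>Cells do not shrink when determined observations are added. Determination is required on
  \<open>G\<close> only, so decoders need to succeed only there.\<close>

lemma joint_entropy_determined:
  assumes "\<And>x y i. \<lbrakk>x \<in> G; y \<in> G; i \<in> B; \<And>a. a \<in> A \<Longrightarrow> g a x = g a y\<rbrakk> \<Longrightarrow> g i x = g i y"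
  shows "H (A \<union> B) = H A"
proof -
  have "cl (A \<union> B) x = cl A x" if "x \<in> G" for x
  proof -
    have "g i y = g i x" if "y \<in> cl A x" "i \<in> B" for y i
      using assms[of y x i] that \<open>x \<in> G\<close> by (simp add: cell_def)
    then show ?thesis by (auto simp: cell_def)
  qed
  then show ?thesis by (simp add: joint_entropy_def)
qed

lemma joint_entropy_injective:
  assumes "\<And>x y. \<lbrakk>x \<in> G; y \<in> G; \<And>a. a \<in> A \<Longrightarrow> g a x = g a y\<rbrakk> \<Longrightarrow> x = y"
  shows "H A = log 2 (card G)"
proof -
  have "cl A x = {x}" if "x \<in> G" for x
  proof -
    have "y = x" if "y \<in> cl A x" for y
      using assms[of y x] that \<open>x \<in> G\<close> by (simp add: cell_def)
    then show ?thesis using self_in_cell[OF that] by blast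
  qed
  then show ?thesis using card_G_pos by (simp add: joint_entropy_def)
qed

text \<open>On each fibre of \<open>g i\<close> the reciprocals of the cell sizes add up to at most
  one, so the weights \<open>?q\<close> have mean at most one.\<close>

lemma joint_entropy_single_le: "H {i} \<le> log 2 (card (g i ` G))"
proof -
  let ?c = "real (card (g i ` G))"
  have c: "?c > 0" using finite_G G_ne by (simp add: card_gt_0_iff)
  let ?q = "\<lambda>x. card G / card (cl {i} x) / ?c"
  have "(\<Sum>x\<in>G. 1 / real (card (cl {i} x))) =
      (\<Sum>y\<in>g i ` G. \<Sum>x\<in>{x\<in>G. g i x = y}. 1 / real (card (cl {i} x)))"
    by (rule sum.image_gen[OF finite_G])
  also have "\<dots> \<le> (\<Sum>y\<in>g i ` G. 1)"
    by (intro sum_mono sum_cell_inverse_le) (auto simp: cell_def)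
  finally have "(\<Sum>x\<in>G. 1 / real (card (cl {i} x))) \<le> ?c" by simp
  then have "card G / ?c * (\<Sum>x\<in>G. 1 / real (card (cl {i} x))) \<le> card G / ?c * ?c"
    by (intro mult_left_mono) auto
  then have "(\<Sum>x\<in>G. ?q x) \<le> card G"
    using c by (simp add: sum_distrib_left mult.commute)
  then have "(\<Sum>x\<in>G. log 2 (?q x)) \<le> 0"
    using c card_G_pos by (intro sum_log_le) (auto simp: card_cell_pos)
  moreover have "log 2 (?q x) = log 2 (card G / card (cl {i} x)) - log 2 ?c" if "x \<in> G" for x
    using c card_G_pos card_cell_pos[OF that, of "{i}"] by (intro log_divide_pos) auto
  ultimately have "(\<Sum>x\<in>G. log 2 (card G / card (cl {i} x))) \<le> card G * log 2 ?c"
    by (simp add: sum_subtractf)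
  then show ?thesis
    unfolding joint_entropy_def using card_G_pos by (simp add: field_simps)
qed

lemma joint_entropy_mono:
  assumes "A \<subseteq> B" shows "H A \<le> H B"
proof -
  have "log 2 (card G / card (cl A x)) \<le> log 2 (card G / card (cl B x))" if "x \<in> G" for x
  proof -
    have "card (cl B x) \<le> card (cl A x)"
      using assms by (intro card_mono finite_cell) (auto simp: cell_def)
    then have "card G / card (cl A x) \<le> card G / card (cl B x)"
      using card_cell_pos[OF that, of B] by (intro divide_left_mono mult_pos_pos) auto
    then show ?thesis
      using card_G_pos card_cell_pos[OF that, of A] by (intro log_mono) auto
  qed
  then show ?thesis
    unfolding joint_entropy_def by (intro divide_right_mono sum_mono) auto
qed

lemma joint_entropy_subadditive: "H (A \<union> B) \<le> H A + H B" if "A \<inter> B = {}"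
  using joint_entropy_submodular[of A B] that joint_entropy_empty by simp

lemma joint_entropy_le_sum:
  assumes "finite A" "\<And>i. i \<in> A \<Longrightarrow> H {i} \<le> m i"
  shows "H A \<le> (\<Sum>i\<in>A. m i)"
  using assms
proof (induction A)
  case (insert i A)
  then show ?case using joint_entropy_subadditive[of "{i}" A] by fastforce
qed (simp add: joint_entropy_empty)

end

lemma card_bits: "card {w::bits. length w = n} = 2 ^ n"
  using card_lists_length_eq[of "UNIV :: bool set" n] by simp

lemma finite_bits: "finite {w::bits. length w = n}"
  using finite_lists_length_eq[of "UNIV :: bool set" n] by simp

lemma (in uniform_source) joint_entropy_bits_le:
  fixes n :: nat
  assumes "\<And>x. x \<in> G \<Longrightarrow> e (g i x) \<in> {w::bits. length w = n}" "inj_on e (g i ` G)"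
  shows "H {i} \<le> n"
proof -
  have "card (g i ` G) \<le> 2 ^ n"
    unfolding card_bits[symmetric] using assms by (intro card_inj_on_le[of e] finite_bits) auto
  then have "log 2 (card (g i ` G)) \<le> log 2 (2 ^ n)"
    using finite_G G_ne by (subst log_le_cancel_iff) (auto simp: card_gt_0_iff simp flip: of_nat_power)
  then show ?thesis using joint_entropy_single_le[of i] by simp
qed

section \<open>Cyclic windows\<close>

text \<open>\<open>h t / t\<close> is the slope of the chord from the origin, and these chords
  flatten for a concave sequence starting at 0.\<close>

lemma concave_ratio_mono:
  fixes h :: "nat \<Rightarrow> real"
  assumes "h 0 = 0" and conc: "\<And>t. t + 2 \<le> K \<Longrightarrow> h (t + 2) + h t \<le> 2 * h (t + 1)"
    and "1 \<le> t" "t \<le> t'" "t' \<le> K"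
  shows "h t' / t' \<le> h t / t"
proof -
  have ratio_step: "t * h (t + 1) \<le> (t + 1) * h t" if "t + 1 \<le> K" for t
    using that
  proof (induction t)
    case (Suc t)
    have "(t + 1) * (h (t + 2) + h t) \<le> (t + 1) * (2 * h (t + 1))"
      using Suc.prems by (intro mult_left_mono conc) auto
    with Suc show ?case by (simp add: algebra_simps)
  qed (simp add: assms(1))
  from assms(4,5) show ?thesis
  proof (induction t' rule: dec_induct)
    case (step n)
    have "h (Suc n) / Suc n \<le> h n / n"
      using ratio_step[of n] step.hyps step.prems assms(3) by (simp add: field_simps)
    then show ?case using step by simp
  qed simp
qed

text \<open>The start \<open>k\<close> is not reduced modulo \<open>K\<close>, so
  \<open>k + 1 = K\<close> is allowed and gives the window at 0. This makes shifts by one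
  uniform.\<close>

definition window :: "nat \<Rightarrow> nat \<Rightarrow> nat \<Rightarrow> nat set" where
  "window K k t = (\<lambda>i. (k + i) mod K) ` {..<t}"

lemma window_0 [simp]: "window K k 0 = {}"
  by (simp add: window_def)

lemma window_1: "k < K \<Longrightarrow> window K k 1 = {k}"
  by (simp add: window_def lessThan_Suc)

lemma window_lt: "p \<in> window K k t \<Longrightarrow> K \<ge> 1 \<Longrightarrow> p < K"
  by (auto simp: window_def)

lemma finite_window [simp]: "finite (window K k t)"
  by (simp add: window_def)

lemma window_wrap: "window K K t = window K 0 t"
  by (simp add: window_def)

lemma add_mod_inj:
  assumes "(k + i) mod K = (k + j) mod K" "i < K" "j < (K::nat)"
  shows "i = j"
  using assms
proof (induction i j rule: linorder_wlog)
  case (le i j)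
  then have "K dvd (k + j) - (k + i)"
    by (subst mod_eq_dvd_iff_nat[symmetric]) simp_all
  then have "K dvd j - i" by simp
  then show ?case using le by (auto dest!: dvd_imp_le)
qed metis

lemma card_window: "t \<le> K \<Longrightarrow> card (window K k t) = t"
  unfolding window_def by (subst card_image) (auto intro!: inj_onI dest!: add_mod_inj)

lemma window_union: "window K k (t + 1) \<union> window K (k + 1) (t + 1) = window K k (t + 2)"
proof -
  have "{..<t + 2} = {..<t + 1} \<union> Suc ` {..<t + 1}"
    using lessThan_Suc_eq_insert_0[of "t + 1"] by auto
  then show ?thesis unfolding window_def by (simp add: image_Un image_image)
qed

text \<open>Room for \<open>t + 2\<close> caches keeps the two windows from meeting a second time
  around the circle: all offsets stay below \<open>K\<close> and are determined by their
  residues.\<close>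

lemma window_inter:
  assumes "t + 2 \<le> K"
  shows "window K k (t + 1) \<inter> window K (k + 1) (t + 1) = window K (k + 1) t"
proof (intro equalityI subsetI)
  fix p assume "p \<in> window K k (t + 1) \<inter> window K (k + 1) (t + 1)"
  then obtain i j where p: "i < t + 1" "j < t + 1" "p = (k + i) mod K" "p = (k + Suc j) mod K"
    by (auto simp: window_def)
  then have "i = Suc j" using assms by (intro add_mod_inj[of k i K]) auto
  with p show "p \<in> window K (k + 1) t" by (auto simp: window_def)
next
  fix p assume "p \<in> window K (k + 1) t"
  then obtain j where "j < t" "p = (k + Suc j) mod K" by (auto simp: window_def)
  then have "p = (k + Suc j) mod K" "Suc j \<in> {..<t + 1}" "p = (k + 1 + j) mod K" "j \<in> {..<t + 1}"
    by auto
  then show "p \<in> window K k (t + 1) \<inter> window K (k + 1) (t + 1)"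
    unfolding window_def by blast
qed

lemma sum_shift_cyclic:
  fixes \<phi> :: "nat \<Rightarrow> real"
  assumes "\<phi> K = \<phi> 0" shows "(\<Sum>k<K. \<phi> (k + 1)) = (\<Sum>k<K. \<phi> k)"
  using sum.lessThan_Suc_shift[of \<phi> K] assms by simp

section \<open>Assignments with many distinct values\<close>

text \<open>The right-hand side is the expected number of distinct values among \<open>n\<close> uniform draws from \<open>N\<close>.\<close>

lemma random_hit_bound:
  fixes N n :: nat
  assumes "N \<ge> 1"
  shows "real (min n N) / 2 \<le> N * (1 - (1 - 1 / N) ^ n)"
proof -
  let ?q = "(1 - 1 / real N) ^ n"
  \<comment> \<open>Bernoulli and \<open>(1 - 1 / N) * (1 + 1 / N) \<le> 1\<close> give
    \<open>?q \<le> N / (N + n)\<close>, which reduces the claim to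
    \<open>min n N / 2 \<le> N * n / (N + n)\<close>.\<close>
  have "1 + n / N \<le> (1 + 1 / real N) ^ n"
    using Bernoulli_inequality[of "1 / real N" n] order_trans[of "-1" 0 "1 / real N"] by simp
  then have "?q * (1 + n / N) \<le> ?q * (1 + 1 / N) ^ n"
    using assms by (intro mult_left_mono) auto
  also have "\<dots> = (1 - (1 / N)^2) ^ n"
    by (simp add: power2_eq_square algebra_simps flip: power_mult_distrib)
  also have "\<dots> \<le> 1" using assms by (intro power_le_one) (auto simp: power_le_one)
  finally have "?q * (N + n) \<le> N" using assms by (simp add: field_simps)
  then have "N * (?q * (N + n)) \<le> real N * N" by (rule mult_left_mono) simp
  then have *: "real N * n \<le> (N * (1 - ?q)) * (N + n)" by (simp add: algebra_simps)
  have "real (min n N) * (N + n) \<le> 2 * (real N * n)"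
  proof (cases "n \<le> N")
    case True then show ?thesis by (simp add: algebra_simps mult_right_mono)
  next
    case False then show ?thesis by (simp add: algebra_simps mult_left_mono)
  qed
  with * have "real (min n N) / 2 * (N + n) \<le> (N * (1 - ?q)) * (N + n)" by simp
  then show ?thesis using assms by (subst (asm) mult_le_cancel_right_pos) auto
qed

text \<open>Linearity of expectation in counting form: a fixed value is missed on \<open>S\<close>
  by a fraction \<open>(1 - 1 / N) ^ card S\<close> of all assignments.\<close>

lemma sum_card_image_PiE:
  fixes N :: nat
  assumes "finite I" "S \<subseteq> I" "N \<ge> 1"
  shows "(\<Sum>f\<in>PiE I (\<lambda>_. {..<N}). real (card (f ` S))) =
    N ^ card I * (N * (1 - (1 - 1 / N) ^ card S))"
proof -
  let ?P = "PiE I (\<lambda>_. {..<N})"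
  have fin: "finite ?P" using assms(1) by (simp add: finite_PiE)
  have cP: "card ?P = N ^ card I" using assms by (simp add: card_PiE)
  have miss: "real (card {f\<in>?P. w \<notin> f ` S}) = N ^ card I * (1 - 1 / N) ^ card S" if "w < N" for w
  proof -
    have "{f\<in>?P. w \<notin> f ` S} = PiE I (\<lambda>i. if i \<in> S then {..<N} - {w} else {..<N})"
      (is "?A = ?B")
    proof (intro equalityI subsetI)
      fix f assume f: "f \<in> ?B"
      have "f i < N \<and> (i \<in> S \<longrightarrow> f i \<noteq> w)" if "i \<in> I" for i
        using PiE_mem[OF f that] by (simp split: if_splits)
      moreover have "f \<in> extensional I" using f by (simp add: PiE_iff)
      ultimately show "f \<in> ?A" using assms(2) by (auto simp: PiE_iff)
    qed (use assms(2) in \<open>auto simp: PiE_iff\<close>)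
    then have "card {f\<in>?P. w \<notin> f ` S} = (\<Prod>i\<in>I. if i \<in> S then N - 1 else N)"
      using assms(1) that by (simp add: card_PiE if_distrib[of card] cong: if_cong)
    also have "\<dots> = (N - 1) ^ card S * N ^ card (I - S)"
      using assms(1,2) by (simp add: prod.If_cases Int_absorb1 Diff_eq)
    finally have "real (card {f\<in>?P. w \<notin> f ` S}) = (real N - 1) ^ card S * real N ^ card (I - S)"
      using assms(3) by (simp add: of_nat_diff)
    also have "real N - 1 = real N * (1 - 1 / N)" using assms(3) by (simp add: field_simps)
    also have "(real N * (1 - 1 / N)) ^ card S * real N ^ card (I - S) =
        real N ^ (card S + card (I - S)) * (1 - 1 / N) ^ card S"
      by (simp add: power_mult_distrib power_add)
    also have "card S + card (I - S) = card I"
      using assms(1,2) by (simp add: card_Diff_subset card_mono finite_subset)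
    finally show ?thesis by simp
  qed
  have "real (card (f ` S)) = (\<Sum>w<N. if w \<in> f ` S then 1 else 0)" if "f \<in> ?P" for f
  proof -
    have "f ` S \<subseteq> {..<N}" using that assms(2) by auto
    then show ?thesis by (simp add: sum.If_cases Int_absorb1)
  qed
  then have "(\<Sum>f\<in>?P. real (card (f ` S))) = (\<Sum>f\<in>?P. \<Sum>w<N. if w \<in> f ` S then 1 else 0)"
    by simp
  also have "\<dots> = (\<Sum>w<N. \<Sum>f\<in>?P. if w \<in> f ` S then 1 else 0)" by (rule sum.swap)
  also have "\<dots> = (\<Sum>w<N. real N ^ card I - N ^ card I * (1 - 1 / N) ^ card S)"
  proof (intro sum.cong refl)
    fix w assume "w \<in> {..<N}"
    then have w: "w < N" by simp
    have "(\<Sum>f\<in>?P. if w \<in> f ` S then 1 else 0) = (\<Sum>f\<in>?P. 1 - (if w \<notin> f ` S then 1 else (0::real)))"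
      by (intro sum.cong) auto
    also have "\<dots> = real (card ?P) - real (card {f\<in>?P. w \<notin> f ` S})"
      using fin by (simp add: sum_subtractf sum.If_cases Int_def)
    finally show "(\<Sum>f\<in>?P. if w \<in> f ` S then 1 else 0) =
        real N ^ card I - N ^ card I * (1 - 1 / N) ^ card S" using miss[OF w] cP by simp
  qed
  finally show ?thesis by (simp add: algebra_simps)
qed

text \<open>First-moment argument: a uniformly random assignment meets the bound in expectation for
  each \<open>S k\<close>, so some assignment meets it for the sum. The sets may overlap.\<close>

lemma exists_covering_assignment:
  fixes S :: "'k \<Rightarrow> 'i set" and N :: nat
  assumes "finite I" "N \<ge> 1" "finite Q" "\<And>k. k \<in> Q \<Longrightarrow> S k \<subseteq> I \<and> card (S k) = n"
  shows "\<exists>f\<in>I \<rightarrow> {..<N}. card Q * (real (min n N) / 2) \<le> (\<Sum>k\<in>Q. real (card (f ` S k)))"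
proof (rule ccontr)
  assume neg: "\<not> ?thesis"
  let ?P = "PiE I (\<lambda>_. {..<N})"
  let ?c = "card Q * (real (min n N) / 2)"
  have fin: "finite ?P" using assms(1) by (simp add: finite_PiE)
  have cP: "card ?P = N ^ card I" using assms by (simp add: card_PiE)
  have ne: "?P \<noteq> {}" using assms(2) by (auto simp: PiE_eq_empty_iff lessThan_empty_iff)
  have "(\<Sum>f\<in>?P. \<Sum>k\<in>Q. real (card (f ` S k))) < (\<Sum>f\<in>?P. ?c)"
    using neg fin ne by (intro sum_strict_mono) (auto simp: PiE_def not_le)
  also have "\<dots> = N ^ card I * ?c" using cP by simp
  also have "\<dots> = (\<Sum>k\<in>Q. N ^ card I * (real (min n N) / 2))" by simp
  also have "\<dots> \<le> (\<Sum>k\<in>Q. \<Sum>f\<in>?P. real (card (f ` S k)))"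
  proof (intro sum_mono)
    fix k assume "k \<in> Q"
    then show "N ^ card I * (real (min n N) / 2) \<le> (\<Sum>f\<in>?P. real (card (f ` S k)))"
      using sum_card_image_PiE[of I "S k" N] assms(1,2) assms(4)[of k]
        mult_left_mono[OF random_hit_bound[OF assms(2), of n], of "real N ^ card I"] by simp
  qed
  also have "\<dots> = (\<Sum>f\<in>?P. \<Sum>k\<in>Q. real (card (f ` S k)))" by (rule sum.swap)
  finally show False by simp
qed

text \<open>Disjointness lets each \<open>S k\<close> be filled separately, which avoids the factor
  of two lost by averaging.\<close>

lemma exists_exact_covering_assignment:
  fixes S :: "'k \<Rightarrow> 'i set" and N :: nat
  assumes "N \<ge> 1" "\<And>k. k \<in> Q \<Longrightarrow> finite (S k) \<and> card (S k) = n"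
    and disj: "disjoint_family_on S Q"
  shows "\<exists>f\<in>UNIV \<rightarrow> {..<N}. \<forall>k\<in>Q. card (f ` S k) = min n N"
proof -
  have "\<forall>k\<in>Q. \<exists>h. h ` S k = {..<min n N}"
  proof
    fix k assume k: "k \<in> Q"
    obtain e where "bij_betw e {0..<n} (S k)"
      using ex_bij_betw_nat_finite[of "S k"] assms(2)[OF k] by auto
    then have "bij_betw (inv_into {0..<n} e) (S k) {0..<n}" by (rule bij_betw_inv_into)
    then have e: "inv_into {0..<n} e ` S k = {..<n}"
      by (simp add: bij_betw_def lessThan_atLeast0)
    \<comment> \<open>Truncating the enumeration at \<open>N - 1\<close> keeps every value
      admissible and still hits each of the first \<open>min n N\<close> values.\<close>
    have "(\<lambda>x. min x (N - 1)) ` {..<n} = {..<min n N}"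
    proof (intro equalityI subsetI)
      fix x assume "x \<in> {..<min n N}"
      then show "x \<in> (\<lambda>x. min x (N - 1)) ` {..<n}" by (intro image_eqI[of _ _ x]) auto
    qed (use assms(1) in auto)
    then have "(\<lambda>i. min (inv_into {0..<n} e i) (N - 1)) ` S k = {..<min n N}"
      using image_image[of "\<lambda>x. min x (N - 1)" "inv_into {0..<n} e" "S k"] by (simp add: e)
    then show "\<exists>h. h ` S k = {..<min n N}" by blast
  qed
  then obtain h where h: "\<And>k. k \<in> Q \<Longrightarrow> h k ` S k = {..<min n N}"
    using bchoice[of Q "\<lambda>k h. h ` S k = {..<min n N}"] by blast
  \<comment> \<open>Disjointness makes the choice of \<open>k\<close> unambiguous; outside all
    \<open>S k\<close> the default 0 is admissible because \<open>N \<ge> 1\<close>.\<close>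
  define f where "f i = (if \<exists>k\<in>Q. i \<in> S k then h (THE k. k \<in> Q \<and> i \<in> S k) i else 0)" for i
  have f: "f i = h k i" if "k \<in> Q" "i \<in> S k" for i k
  proof -
    have "(THE k. k \<in> Q \<and> i \<in> S k) = k"
      using that disj by (intro the_equality) (auto simp: disjoint_family_on_def)
    then show ?thesis using that by (auto simp: f_def)
  qed
  have img: "f ` S k = {..<min n N}" if "k \<in> Q" for k
  proof -
    have "f ` S k = h k ` S k" using f[OF that] by (intro image_cong) auto
    then show ?thesis using h[OF that] by simp
  qed
  have "f i < N" for i
  proof (cases "\<exists>k\<in>Q. i \<in> S k")
    case True
    then obtain k where "k \<in> Q" "f i \<in> f ` S k" by blast
    then show ?thesis using img[of k] by simp
  next
    case False
    then show ?thesis using assms(1) by (auto simp: f_def)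
  qed
  then show ?thesis using img by (intro bexI[of _ f]) auto
qed

section \<open>Libraries on which all users succeed\<close>

text \<open>Union bound: the bad events together have probability at most 1/2.\<close>

lemma card_le_twice_avoiding:
  fixes \<epsilon> :: real
  assumes "finite S" "S \<noteq> {}" "finite Q"
    and "\<And>q. q \<in> Q \<Longrightarrow> measure_pmf.prob (pmf_of_set S) (E q) \<le> \<epsilon>"
    and "card Q * \<epsilon> \<le> 1 / 2"
  shows "card S \<le> 2 * card (S - (\<Union>q\<in>Q. E q))"
proof -
  have "measure_pmf.prob (pmf_of_set S) (\<Union>q\<in>Q. E q) \<le> (\<Sum>q\<in>Q. measure_pmf.prob (pmf_of_set S) (E q))"
    using assms(3) by (intro measure_pmf.finite_measure_subadditive_finite) auto
  also have "\<dots> \<le> card Q * \<epsilon>" using sum_bounded_above[of Q _ \<epsilon>] assms(4) by simp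
  also note assms(5)
  finally have "real (card (S \<inter> (\<Union>q\<in>Q. E q))) / card S \<le> 1 / 2"
    using assms(1,2) by (simp add: measure_pmf_of_set)
  then have "2 * card (S \<inter> (\<Union>q\<in>Q. E q)) \<le> card S"
    using assms(1,2) by (simp add: field_simps card_gt_0_iff)
  moreover have "card S = card (S \<inter> (\<Union>q\<in>Q. E q)) + card (S - (\<Union>q\<in>Q. E q))"
    using assms(1) by (metis card_Int_Diff)
  ultimately show ?thesis by linarith
qed

lemma finite_files: "finite (files L N)"
  by (auto simp: files_def)

text \<open>The support of \<open>library_pmf\<close>. Entries outside \<open>files L N\<close> are
  fixed to \<open>[]\<close>, so a library is determined by its files.\<close>

definition libraries :: "nat \<Rightarrow> (nat \<Rightarrow> nat) \<Rightarrow> nat \<Rightarrow> library set" where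
  "libraries L N F = PiE_dflt (files L N) [] (\<lambda>_. {w. length w = F})"

lemma finite_libraries: "finite (libraries L N F)"
  unfolding libraries_def by (intro finite_PiE_dflt finite_files finite_bits)

lemma card_libraries: "card (libraries L N F) = 2 ^ (F * card (files L N))"
  by (simp add: libraries_def card_PiE_dflt finite_files finite_bits card_bits power_mult)

lemma library_pmf_uniform: "library_pmf L N F = pmf_of_set (libraries L N F)"
  unfolding library_pmf_def libraries_def
  using Ex_list_of_length by (intro Pi_pmf_of_set finite_files finite_bits) auto

section \<open>The sliding-window bound\<close>

text \<open>A single index type for all observations, so that \<open>joint_entropy\<close> applies
  to mixed sets of caches, broadcasts and files.\<close>

datatype source = Cache nat | Broadcast nat nat | File "nat \<times> nat"

text \<open>One placement, and for every cache \<open>b\<close> broadcasts, each with its own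
  request profile. Decoding is free of errors on \<open>G\<close>.\<close>

locale correct_delivery =
  fixes L K b F m :: nat and N U d :: "nat \<Rightarrow> nat" and G :: "library set"
    and Z :: "nat \<Rightarrow> library \<Rightarrow> bits" and X :: "nat \<Rightarrow> nat \<Rightarrow> library \<Rightarrow> bits"
    and n :: "nat \<Rightarrow> nat \<Rightarrow> nat" and \<delta> :: "nat \<Rightarrow> nat \<Rightarrow> user \<Rightarrow> bits \<Rightarrow> bits list \<Rightarrow> bits"
    and r :: "nat \<Rightarrow> nat \<Rightarrow> user \<Rightarrow> nat"
  assumes K_pos: "K \<ge> 1"
    and G_sub: "G \<subseteq> libraries L N F"
    and G_large: "card (libraries L N F) \<le> 2 * card G"
    and length_Z: "\<And>k W. k < K \<Longrightarrow> length (Z k W) = m"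
    and length_X: "\<And>k \<beta> W. \<lbrakk>k < K; \<beta> < b\<rbrakk> \<Longrightarrow> length (X k \<beta> W) = n k \<beta>"
    and decode: "\<And>k \<beta> v W. \<lbrakk>k < K; \<beta> < b; v \<in> users L K U; W \<in> G\<rbrakk> \<Longrightarrow>
      \<delta> k \<beta> v (X k \<beta> W) (accessed K d (\<lambda>k. Z k W) v) = W (fst v, r k \<beta> v)"
begin

definition reading :: "source \<Rightarrow> library \<Rightarrow> bits" where
  "reading s W = (case s of Cache k \<Rightarrow> Z k W | Broadcast k \<beta> \<Rightarrow> X k \<beta> W | File f \<Rightarrow> W f)"

lemma reading_simps [simp]:
  "reading (Cache k) W = Z k W" "reading (Broadcast k \<beta>) W = X k \<beta> W" "reading (File f) W = W f"
  by (simp_all add: reading_def)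

lemma G_nonempty: "G \<noteq> {}"
  using G_large by (auto simp: card_libraries)

sublocale uniform_source G reading
  using finite_subset[OF G_sub finite_libraries] G_nonempty by unfold_locales

text \<open>\<open>block {k}\<close> is the \<open>Y k\<close> of the overview. Broadcasts carry the
  index of their cache, so \<open>block\<close> commutes with unions and intersections and
  submodularity can act on windows.\<close>

definition block :: "nat set \<Rightarrow> source set" where
  "block T = Cache ` T \<union> (\<lambda>(k, \<beta>). Broadcast k \<beta>) ` (T \<times> {..<b})"

lemma block_Un: "block (S \<union> T) = block S \<union> block T"
  by (auto simp: block_def)

lemma block_Int: "block (S \<inter> T) = block S \<inter> block T"
  by (auto simp: block_def)

lemma entropy_block_le:
  assumes "k < K" shows "H (block {k}) \<le> m + (\<Sum>\<beta><b. n k \<beta>)"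
proof -
  let ?w = "\<lambda>s. real (case s of Cache k \<Rightarrow> m | Broadcast k \<beta> \<Rightarrow> n k \<beta> | File f \<Rightarrow> 0)"
  have blk: "block {k} = insert (Cache k) (Broadcast k ` {..<b})" by (auto simp: block_def)
  have "H (block {k}) \<le> (\<Sum>s\<in>block {k}. ?w s)"
  proof (intro joint_entropy_le_sum)
    fix s assume "s \<in> block {k}"
    then show "H {s} \<le> ?w s" unfolding blk
      using assms length_Z length_X by (intro joint_entropy_bits_le[of id]) auto
  qed (simp add: blk)
  also have "\<dots> = ?w (Cache k) + (\<Sum>s\<in>Broadcast k ` {..<b}. ?w s)"
    unfolding blk by (subst sum.insert) auto
  also have "(\<Sum>s\<in>Broadcast k ` {..<b}. ?w s) = (\<Sum>\<beta><b. real (n k \<beta>))"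
    by (subst sum.reindex) (auto intro!: inj_onI)
  finally show ?thesis by simp
qed

lemma library_file_length: "W \<in> G \<Longrightarrow> f \<in> files L N \<Longrightarrow> length (W f) = F"
  using subsetD[OF G_sub, of W] by (simp add: libraries_def PiE_dflt_def del: split_paired_All)

lemma entropy_files_le:
  assumes "C \<subseteq> files L N" shows "H (File ` C) \<le> F * card C"
proof -
  have fin: "finite C" using assms finite_files finite_subset by blast
  have "H (File ` C) \<le> (\<Sum>s\<in>File ` C. real F)"
  proof (intro joint_entropy_le_sum)
    fix s assume "s \<in> File ` C"
    then show "H {s} \<le> real F"
      using assms library_file_length by (intro joint_entropy_bits_le[of id]) auto
  qed (simp add: fin)
  then show ?thesis by (simp add: card_image inj_on_def mult.commute)
qed

text \<open>All files together have entropy \<open>log 2 (card G)\<close>, at most one bit below the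
  maximum. Files outside \<open>C\<close> contribute at most \<open>F\<close> bits each, so the
  deficit of \<open>C\<close> is at most that one bit, however large \<open>C\<close> is.\<close>

lemma entropy_files_ge:
  assumes "C \<subseteq> files L N" shows "real F * card C - 1 \<le> H (File ` C)"
proof -
  have "H (File ` files L N) = log 2 (card G)"
  proof (intro joint_entropy_injective ext)
    fix x y f assume *: "x \<in> G" "y \<in> G" "\<And>a. a \<in> File ` files L N \<Longrightarrow> reading a x = reading a y"
    show "x f = y f"
    proof (cases "f \<in> files L N")
      case True then show ?thesis using *(3)[of "File f"] by simp
    next
      case False
      then show ?thesis
        using subsetD[OF G_sub *(1)] subsetD[OF G_sub *(2)] by (simp add: libraries_def PiE_dflt_def del: split_paired_All)
    qed
  qed
  moreover have "real F * card (files L N) - 1 \<le> log 2 (card G)"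
  proof -
    have "real (2 ^ (F * card (files L N))) \<le> 2 * real (card G)"
      using G_large unfolding card_libraries by (metis of_nat_le_iff of_nat_mult of_nat_numeral)
    then have "log 2 (2 ^ (F * card (files L N))) \<le> log 2 (2 * real (card G))"
      using card_G_pos by (intro log_mono) auto
    then show ?thesis using card_G_pos by (simp add: log_mult_pos)
  qed
  moreover have "H (File ` files L N) \<le> H (File ` C) + H (File ` (files L N - C))"
    using joint_entropy_subadditive[of "File ` C" "File ` (files L N - C)"] assms
    by (auto simp: Un_absorb1 simp flip: image_Un)
  moreover have "H (File ` (files L N - C)) \<le> F * card (files L N - C)"
    by (intro entropy_files_le) auto
  moreover have "real (card (files L N)) = card C + card (files L N - C)"
    using assms finite_files by (simp add: card_Diff_subset card_mono finite_subset of_nat_diff)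
  ultimately show ?thesis by (simp add: algebra_simps)
qed

section \<open>Entropy of sliding windows, summed over their positions\<close>

definition window_entropy :: "source set \<Rightarrow> nat \<Rightarrow> real" where
  "window_entropy C t = (\<Sum>k<K. H (block (window K k t) \<union> C) - H C)"

lemma window_entropy_nonneg: "window_entropy C t \<ge> 0"
  unfolding window_entropy_def by (intro sum_nonneg) (simp add: joint_entropy_mono)

text \<open>Submodularity for the windows of length \<open>t + 1\<close> at \<open>k\<close> and
  \<open>k + 1\<close> yields windows of lengths \<open>t + 2\<close> and \<open>t\<close>. Summing
  cyclically over \<open>k\<close> removes the shift and leaves concavity in the length.\<close>

lemma window_entropy_ratio:
  assumes "1 \<le> t" "t \<le> t'" "t' \<le> K"
  shows "window_entropy C t' / t' \<le> window_entropy C t / t"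
proof (rule concave_ratio_mono[OF _ _ assms])
  show "window_entropy C 0 = 0" by (simp add: window_entropy_def block_def)
next
  fix t assume t: "t + 2 \<le> K"
  let ?e = "\<lambda>k t. H (block (window K k t) \<union> C)"
  have "?e k (t + 2) + ?e (k + 1) t \<le> ?e k (t + 1) + ?e (k + 1) (t + 1)" for k
  proof -
    let ?A = "block (window K k (t + 1))" and ?B = "block (window K (k + 1) (t + 1))"
    have "(?A \<union> C) \<union> (?B \<union> C) = block (window K k (t + 2)) \<union> C"
      unfolding window_union[symmetric] block_Un by blast
    moreover have "(?A \<union> C) \<inter> (?B \<union> C) = block (window K (k + 1) t) \<union> C"
      unfolding window_inter[OF t, symmetric] block_Int by blast
    ultimately show ?thesis using joint_entropy_submodular[of "?A \<union> C" "?B \<union> C"] by simp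
  qed
  then have "(\<Sum>k<K. ?e k (t + 2) + ?e (k + 1) t) \<le> (\<Sum>k<K. ?e k (t + 1) + ?e (k + 1) (t + 1))"
    by (rule sum_mono)
  moreover have "(\<Sum>k<K. ?e (k + 1) s) = (\<Sum>k<K. ?e k s)" for s
    by (rule sum_shift_cyclic) (simp add: window_wrap)
  ultimately show "window_entropy C (t + 2) + window_entropy C t \<le> 2 * window_entropy C (t + 1)"
    by (simp add: window_entropy_def sum.distrib sum_subtractf)
qed

definition decodable :: "nat \<Rightarrow> nat set \<Rightarrow> nat set" where
  "decodable j T = {r k \<beta> (j, p, u) | k \<beta> p u. k \<in> T \<and> \<beta> < b \<and> p < K \<and> u < U j \<and>
     (\<forall>i<d j. (p + i) mod K \<in> T)}"

abbreviation level_files :: "nat set \<Rightarrow> source set" where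
  "level_files J \<equiv> File ` (SIGMA i:J. {..<N i})"

text \<open>The block and the files of \<open>J\<close> determine the files \<open>Q\<close> of
  level \<open>j\<close>, so these are adjoined for free. Submodularity against
  \<open>level_files (insert j J)\<close> then splits off their entropy; the lost bit comes from
  \<open>entropy_files_ge\<close>.\<close>

lemma entropy_decodable:
  assumes "T \<subseteq> {..<K}" "j \<in> {1..L}" "J \<subseteq> {1..L}" "j \<notin> J"
    and "Q \<subseteq> decodable j T" "Q \<subseteq> {..<N j}"
  shows "real F * card Q - 1 + (H (block T \<union> level_files (insert j J)) - H (level_files (insert j J)))
    \<le> H (block T \<union> level_files J) - H (level_files J)"
proof -
  let ?C = "SIGMA i:J. {..<N i}"
  let ?S = "{j} \<times> Q"
  have fin: "finite ?C" "finite Q"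
    using assms(3,6) finite_subset[of J "{1..L}"] finite_subset[of Q] by auto
  have sub: "?C \<subseteq> files L N" "?C \<union> ?S \<subseteq> files L N" using assms(2,3,6) by (auto simp: files_def)
  have card: "card (?C \<union> ?S) = card ?C + card Q"
    using assms(4) fin by (subst card_Un_disjoint) (auto simp: card_cartesian_product)
  have "H ((block T \<union> File ` ?C) \<union> File ` ?S) = H (block T \<union> File ` ?C)"
  proof (rule joint_entropy_determined)
    fix x y s assume xy: "x \<in> G" "y \<in> G" and "s \<in> File ` ?S"
      and agree: "\<And>a. a \<in> block T \<union> File ` ?C \<Longrightarrow> reading a x = reading a y"
    then obtain q where q: "s = File (j, q)" "q \<in> decodable j T" using assms(5) by auto
    then obtain k \<beta> p u where k: "q = r k \<beta> (j, p, u)" "k \<in> T" "\<beta> < b" "p < K" "u < U j"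
      "\<And>i. i < d j \<Longrightarrow> (p + i) mod K \<in> T" by (auto simp: decodable_def)
    have "accessed K d (\<lambda>k. Z k x) (j, p, u) = accessed K d (\<lambda>k. Z k y) (j, p, u)"
      using agree[of "Cache _"] k(6) by (simp add: accessed_def block_def)
    moreover have "X k \<beta> x = X k \<beta> y"
      using agree[of "Broadcast k \<beta>"] k(2,3) by (force simp: block_def)
    moreover have "k < K" "(j, p, u) \<in> users L K U"
      using k assms(1,2) by (auto simp: users_def)
    ultimately have "x (j, q) = y (j, q)"
      using decode[of k \<beta> "(j, p, u)" x] decode[of k \<beta> "(j, p, u)" y] xy k(1,3) by simp
    then show "reading s x = reading s y" by (simp add: q)
  qed
  moreover have "(block T \<union> File ` ?C \<union> File ` ?S) \<union> level_files (insert j J) =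
      block T \<union> level_files (insert j J)" using assms(6) by auto
  \<comment> \<open>Blocks contain no file sources, so only the files of \<open>J\<close> and
    \<open>Q\<close> are common. Their entropy supplies the gain \<open>F * card Q\<close>.\<close>
  moreover have "(block T \<union> File ` ?C \<union> File ` ?S) \<inter> level_files (insert j J) = File ` (?C \<union> ?S)"
    using assms(4,6) by (auto simp: block_def)
  ultimately have "H (block T \<union> level_files (insert j J)) + H (File ` (?C \<union> ?S)) \<le>
      H (block T \<union> File ` ?C) + H (level_files (insert j J))"
    using joint_entropy_submodular[of "block T \<union> File ` ?C \<union> File ` ?S" "level_files (insert j J)"]
    by simp
  moreover have "real F * card ?C + real F * card Q - 1 \<le> H (File ` (?C \<union> ?S))"
    using entropy_files_ge[OF sub(2)] by (simp add: card algebra_simps)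
  moreover have "H (File ` ?C) \<le> real F * card ?C" using entropy_files_le[OF sub(1)] by simp
  ultimately show ?thesis by linarith
qed

text \<open>\<open>C\<close> collects the levels already conditioned on and \<open>t0\<close> is the
  current window length; both change along the induction. The negated ranking makes the inserted
  level one of least \<open>t j\<close>, which is the next to be visited.\<close>

lemma window_entropy_chain:
  fixes t :: "nat \<Rightarrow> nat" and Q :: "nat \<Rightarrow> nat \<Rightarrow> nat set"
  assumes "finite J" "J \<subseteq> {1..L}" "C \<subseteq> {1..L}" "J \<inter> C = {}"
    and "1 \<le> t0" "\<And>j. j \<in> J \<Longrightarrow> t0 \<le> t j \<and> t j \<le> K"
    and "\<And>j k. j \<in> J \<Longrightarrow> k < K \<Longrightarrow> Q j k \<subseteq> decodable j (window K k (t j)) \<inter> {..<N j}"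
  shows "(\<Sum>j\<in>J. (\<Sum>k<K. real F * card (Q j k) - 1) / t j) \<le> window_entropy (level_files C) t0 / t0"
  using assms
proof (induction J arbitrary: C t0 rule: finite_ranking_induct[where f = "\<lambda>j. - int (t j)"])
  case empty
  then show ?case by (simp add: window_entropy_nonneg)
next
  case (insert j J)
  show ?case
  proof (cases "j \<in> J")
    case True
    then show ?thesis using insert by (simp add: insert_absorb)
  next
    case False
    have tj: "1 \<le> t j" "t0 \<le> t j" "t j \<le> K" using insert.prems(4) insert.prems(5)[of j] by auto
    have "(\<Sum>i\<in>J. (\<Sum>k<K. real F * card (Q i k) - 1) / t i) \<le>
        window_entropy (level_files (insert j C)) (t j) / t j"
    proof (rule insert.IH)
      show "t j \<le> t i \<and> t i \<le> K" if "i \<in> J" for i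
        using insert.hyps(2)[OF that] insert.prems(5)[of i] that by simp
      show "Q i k \<subseteq> decodable i (window K k (t i)) \<inter> {..<N i}" if "i \<in> J" "k < K" for i k
        using insert.prems(6)[of i k] that by simp
    qed (use insert.prems False tj(1) in simp_all)
    moreover have "(\<Sum>k<K. real F * card (Q j k) - 1) + window_entropy (level_files (insert j C)) (t j)
        \<le> window_entropy (level_files C) (t j)"
      unfolding window_entropy_def sum.distrib[symmetric]
    proof (intro sum_mono entropy_decodable)
      fix k assume "k \<in> {..<K}"
      then show "Q j k \<subseteq> decodable j (window K k (t j))" "Q j k \<subseteq> {..<N j}"
        using insert.prems(6)[of j k] by auto
    qed (use insert.prems window_lt K_pos in auto)
    then have "(\<Sum>k<K. real F * card (Q j k) - 1) / t j +
        window_entropy (level_files (insert j C)) (t j) / t j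
        \<le> window_entropy (level_files C) (t j) / t j"
      by (simp add: divide_right_mono flip: add_divide_distrib)
    moreover have "window_entropy (level_files C) (t j) / t j \<le> window_entropy (level_files C) t0 / t0"
      using insert.prems(4) tj by (intro window_entropy_ratio) auto
    ultimately show ?thesis using insert.hyps(1) False by simp
  qed
qed

text \<open>The chain starts at length one with nothing conditioned on, where the window entropy is
  the sum over single blocks.\<close>

lemma cut_set_bound:
  fixes t :: "nat \<Rightarrow> nat" and Q :: "nat \<Rightarrow> nat \<Rightarrow> nat set"
  assumes "J \<subseteq> {1..L}" "\<And>j. j \<in> J \<Longrightarrow> 1 \<le> t j \<and> t j \<le> K"
    and "\<And>j k. j \<in> J \<Longrightarrow> k < K \<Longrightarrow> Q j k \<subseteq> decodable j (window K k (t j)) \<inter> {..<N j}"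
  shows "(\<Sum>j\<in>J. (\<Sum>k<K. real F * card (Q j k) - 1) / t j) \<le> (\<Sum>k<K. m + (\<Sum>\<beta><b. real (n k \<beta>)))"
proof -
  have "finite J" using assms(1) finite_subset by blast
  then have "(\<Sum>j\<in>J. (\<Sum>k<K. real F * card (Q j k) - 1) / t j) \<le> window_entropy (level_files {}) 1 / 1"
    using window_entropy_chain[of J "{}" 1 t Q] assms by simp
  also have "\<dots> = (\<Sum>k<K. H (block {k}))"
    using joint_entropy_empty by (simp add: window_entropy_def window_1 flip: One_nat_def)
  also have "\<dots> \<le> (\<Sum>k<K. m + (\<Sum>\<beta><b. real (n k \<beta>)))"
    using entropy_block_le by (intro sum_mono) auto
  finally show ?thesis .
qed

end

section \<open>Choice of the requests\<close>

text \<open>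
  A delivery \<open>(k, \<beta>, p, u)\<close> stands for the request of the \<open>u\<close>-th user at position \<open>p\<close> in the \<open>\<beta>\<close>-th
  broadcast attached to cache \<open>k\<close>.
\<close>

definition deliveries :: "nat \<Rightarrow> nat \<Rightarrow> nat \<Rightarrow> (nat \<times> nat \<times> nat \<times> nat) set" where
  "deliveries K b U = {..<K} \<times> {..<b} \<times> {..<K} \<times> {..<U}"

text \<open>The \<open>d\<close> caches of a user lie inside the window without wrapping past its
  end exactly for the first \<open>t - d + 1\<close> positions.\<close>

definition window_deliveries ::
  "nat \<Rightarrow> nat \<Rightarrow> nat \<Rightarrow> nat \<Rightarrow> nat \<Rightarrow> nat \<Rightarrow> (nat \<times> nat \<times> nat \<times> nat) set" where
  "window_deliveries K b U d t k = window K k t \<times> {..<b} \<times> window K k (t - d + 1) \<times> {..<U}"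

lemma window_deliveries_subset: "K \<ge> 1 \<Longrightarrow> window_deliveries K b U d t k \<subseteq> deliveries K b U"
  by (auto simp: window_deliveries_def deliveries_def dest: window_lt)

lemma finite_deliveries: "finite (deliveries K b U)"
  by (simp add: deliveries_def)

lemma finite_window_deliveries: "finite (window_deliveries K b U d t k)"
  by (simp add: window_deliveries_def)

lemma card_window_deliveries:
  assumes "1 \<le> d" "d \<le> t" "t \<le> K"
  shows "card (window_deliveries K b U d t k) = t * b * (t - d + 1) * U"
  unfolding window_deliveries_def using assms by (simp add: card_cartesian_product card_window algebra_simps)

lemma (in correct_delivery) image_window_deliveries_decodable:
  assumes "\<And>k \<beta> p u. r k \<beta> (j, p, u) = f (k, \<beta>, p, u)" "d j \<le> t"
  shows "f ` window_deliveries K b (U j) (d j) t k \<subseteq> decodable j (window K k t)"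
proof
  fix q assume "q \<in> f ` window_deliveries K b (U j) (d j) t k"
  then obtain k' \<beta> p u where *: "q = f (k', \<beta>, p, u)" "k' \<in> window K k t" "\<beta> < b"
      "p \<in> window K k (t - d j + 1)" "u < U j"
    by (auto simp: window_deliveries_def)
  then obtain i where i: "p = (k + i) mod K" "i < t - d j + 1" by (auto simp: window_def)
  have "(p + i') mod K \<in> window K k t" if "i' < d j" for i'
  proof -
    have "(p + i') mod K = (k + (i + i')) mod K" by (simp add: i mod_add_left_eq add.assoc)
    moreover have "i + i' < t" using i that assms(2) by linarith
    ultimately show ?thesis by (auto simp: window_def)
  qed
  moreover have "p < K" using *(4) K_pos by (rule window_lt)
  ultimately show "q \<in> decodable j (window K k t)"
    unfolding decodable_def mem_Collect_eq using * assms(1)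
    by (intro exI[of _ k'] exI[of _ \<beta>] exI[of _ p] exI[of _ u]) simp
qed

section \<open>From an achievable rate to the cut-set inequality\<close>

lemma card_libraries_le_twice_correct:
  fixes \<epsilon> :: real
  assumes "\<And>q. q \<in> P \<Longrightarrow> error_prob L K N U d F Z (r q) (X q) (\<delta> q) \<le> \<epsilon>"
    and "finite P" "card P * \<epsilon> \<le> 1 / 2"
  defines "G \<equiv> {W \<in> libraries L N F. \<forall>q\<in>P. \<forall>v\<in>users L K U.
      \<delta> q v (X q W) (accessed K d (\<lambda>k. Z k W) v) = W (fst v, r q v)}"
  shows "card (libraries L N F) \<le> 2 * card G"
proof -
  define E where "E q = {W. \<exists>v\<in>users L K U.
      \<delta> q v (X q W) (accessed K d (\<lambda>k. Z k W) v) \<noteq> W (fst v, r q v)}" for q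
  have "libraries L N F \<noteq> {}" using card_libraries[of L N F] by auto
  then have "card (libraries L N F) \<le> 2 * card (libraries L N F - (\<Union>q\<in>P. E q))"
    using assms(1-3)
    by (intro card_le_twice_avoiding[of _ _ _ \<epsilon>] finite_libraries)
       (auto simp: error_prob_def library_pmf_uniform E_def)
  also have "libraries L N F - (\<Union>q\<in>P. E q) = G" by (auto simp: G_def E_def)
  finally show ?thesis .
qed

text \<open>If the inequality failed, the excess would grow linearly in \<open>F\<close>, while the
  bits lost in \<open>cut_set_bound\<close> add up to the constant \<open>c\<close>. Large
  \<open>F\<close> gives a contradiction.\<close>

lemma achievable_cut_set:
  fixes t :: "nat \<Rightarrow> nat" and f :: "nat \<Rightarrow> nat \<times> nat \<times> nat \<times> nat \<Rightarrow> nat"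
  assumes ach: "achievable L K N U d R M" and "K \<ge> 1" "b \<ge> 1" "M \<ge> 0"
    and N: "\<And>i. i \<in> {1..L} \<Longrightarrow> N i \<ge> 1"
    and J: "J \<subseteq> {1..L}" and t: "\<And>j. j \<in> J \<Longrightarrow> 1 \<le> d j \<and> d j \<le> t j \<and> t j \<le> K"
    and f: "\<And>j. j \<in> J \<Longrightarrow> f j \<in> deliveries K b (U j) \<rightarrow> {..<N j}"
  shows "(\<Sum>j\<in>J. (\<Sum>k<K. real (card (f j ` window_deliveries K b (U j) (d j) (t j) k))) / t j)
    \<le> K * (M + b * R)"
proof (rule ccontr)
  let ?Q = "\<lambda>j k. f j ` window_deliveries K b (U j) (d j) (t j) k"
  define a where "a = (\<Sum>j\<in>J. (\<Sum>k<K. real (card (?Q j k))) / t j)"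
  define c where "c = (\<Sum>j\<in>J. real K / t j)"
  define gap where "gap = a - K * (M + b * R)"
  assume "\<not> ?thesis"
  then have gap: "gap > 0" by (simp add: gap_def a_def)
  \<comment> \<open>Two demands are met: the errors of all \<open>K * b\<close> broadcasts sum to at
    most 1/2, and the rate slack consumes at most half of \<open>gap\<close>.\<close>
  define \<epsilon> where "\<epsilon> = min 1 gap / (2 * K * b)"
  have Kb: "real K * b > 0" using assms(2,3) by simp
  have \<epsilon>: "\<epsilon> > 0" "real K * b * \<epsilon> \<le> 1 / 2" "real K * b * \<epsilon> \<le> gap / 2"
    using gap Kb by (auto simp: \<epsilon>_def min_def)
  \<comment> \<open>Levels outside \<open>J\<close> request file 0, which exists because
    \<open>N i \<ge> 1\<close>.\<close>
  define r where "r k \<beta> = (\<lambda>(i, p, u). if i \<in> J then f i (k, \<beta>, p, u) else 0)"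
    for k \<beta> :: nat
  have r: "r k \<beta> \<in> requests L K N U" if "k < K" "\<beta> < b" for k \<beta>
  proof -
    have "f i (k, \<beta>, p, u) < N i" if "i \<in> J" "p < K" "u < U i" for i p u
      using Pi_mem[OF f[OF that(1)], of "(k, \<beta>, p, u)"] that \<open>k < K\<close> \<open>\<beta> < b\<close>
      by (simp add: deliveries_def)
    moreover have "0 < N i" if "i \<in> {1..L}" for i using N[OF that] by simp
    ultimately show ?thesis
      unfolding requests_def by (intro Pi_I) (auto simp: users_def r_def)
  qed
  have bound: "a * F - c \<le> K * (M * F + b * ((R + \<epsilon>) * F))"
    if "\<forall>k<K. \<forall>W. length (Z k W) = nat \<lfloor>M * real F\<rfloor>"
      "\<forall>r\<in>requests L K N U. \<exists>n X \<delta>.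
         real n \<le> (R + \<epsilon>) * real F \<and> (\<forall>W. length (X W) = n) \<and> error_prob L K N U d F Z r X \<delta> \<le> \<epsilon>"
    for F Z
  proof -
    let ?P = "{..<K} \<times> {..<b}"
    define good where "good q n X \<delta> \<longleftrightarrow> real n \<le> (R + \<epsilon>) * real F \<and> (\<forall>W. length (X W) = n) \<and>
        error_prob L K N U d F Z (r (fst q) (snd q)) X \<delta> \<le> \<epsilon>" for q n X \<delta>
    have "\<forall>q\<in>?P. \<exists>n X \<delta>. good q n X \<delta>"
      using that(2) r by (auto simp: good_def)
    then obtain n X \<delta> where "\<And>q. q \<in> ?P \<Longrightarrow> good q (n q) (X q) (\<delta> q)"
      by metis
    then have sch: "real (n q) \<le> (R + \<epsilon>) * real F \<and> (\<forall>W. length (X q W) = n q) \<and>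
        error_prob L K N U d F Z (r (fst q) (snd q)) (X q) (\<delta> q) \<le> \<epsilon>" if "q \<in> ?P" for q
      using that unfolding good_def by blast
    define G where "G = {W \<in> libraries L N F. \<forall>q\<in>?P. \<forall>v\<in>users L K U.
      \<delta> q v (X q W) (accessed K d (\<lambda>k. Z k W) v) = W (fst v, r (fst q) (snd q) v)}"
    have large: "card (libraries L N F) \<le> 2 * card G"
      unfolding G_def using sch \<epsilon>(2)
      by (intro card_libraries_le_twice_correct[where \<epsilon> = \<epsilon>]) (auto simp: card_cartesian_product)
    interpret correct_delivery L K b F "nat \<lfloor>M * real F\<rfloor>" N U d G Z
      "\<lambda>k \<beta>. X (k, \<beta>)" "\<lambda>k \<beta>. n (k, \<beta>)" "\<lambda>k \<beta>. \<delta> (k, \<beta>)" r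
    proof
      show "G \<subseteq> libraries L N F" by (auto simp: G_def)
      fix k \<beta> v W assume "k < K" "\<beta> < b" "v \<in> users L K U" "W \<in> G"
      then show "\<delta> (k, \<beta>) v (X (k, \<beta>) W) (accessed K d (\<lambda>k. Z k W) v) = W (fst v, r k \<beta> v)"
        by (fastforce simp: G_def)
    qed (use assms(2) large that(1) sch in auto)
    have "?Q j k \<subseteq> decodable j (window K k (t j)) \<inter> {..<N j}" if "j \<in> J" "k < K" for j k
      using image_window_deliveries_decodable[of j "f j" "t j" k] t[OF that(1)] f[OF that(1)] that(1)
        window_deliveries_subset[OF assms(2), of b "U j" "d j" "t j" k]
      by (auto simp: r_def)
    then have "(\<Sum>j\<in>J. (\<Sum>k<K. real F * card (?Q j k) - 1) / t j) \<le>
        (\<Sum>k<K. nat \<lfloor>M * real F\<rfloor> + (\<Sum>\<beta><b. real (n (k, \<beta>))))"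
      using t by (intro cut_set_bound J) force+
    also have "\<dots> \<le> (\<Sum>k<K. M * F + (\<Sum>\<beta><b. (R + \<epsilon>) * F))"
      using sch assms(4) by (intro sum_mono add_mono) auto
    also have "\<dots> = K * (M * F + b * ((R + \<epsilon>) * F))" by simp
    also have "(\<Sum>j\<in>J. (\<Sum>k<K. real F * card (?Q j k) - 1) / t j) = a * F - c"
    proof -
      have "(\<Sum>k<K. real F * card (?Q j k) - 1) / t j =
          F * ((\<Sum>k<K. real (card (?Q j k))) / t j) - K / t j" for j
        by (simp add: sum_subtractf diff_divide_distrib flip: sum_distrib_left)
      then have "(\<Sum>j\<in>J. (\<Sum>k<K. real F * card (?Q j k) - 1) / t j) = F * a - c"
        unfolding a_def c_def sum_distrib_left[of "real F" _ J] by (simp only: sum_subtractf)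
      then show ?thesis by (simp only: mult.commute)
    qed
    finally show ?thesis .
  qed
  have "\<forall>\<^sub>F F in sequentially. a * real F - c \<le> K * (M * F + b * ((R + \<epsilon>) * F))"
    using ach[unfolded achievable_def, rule_format, OF \<epsilon>(1)]
    by eventually_elim (use bound in blast)
  moreover have "\<forall>\<^sub>F F in sequentially. real F > c / (gap / 2)"
    using filterlim_real_sequentially filterlim_at_top_dense by blast
  ultimately have "\<forall>\<^sub>F F::nat in sequentially. False"
  proof eventually_elim
    case (elim F)
    have "c < gap / 2 * F" using elim(2) gap by (simp add: field_simps)
    also have "\<dots> \<le> (gap - K * b * \<epsilon>) * F" using \<epsilon>(3) by (intro mult_right_mono) auto
    also have "\<dots> = a * F - K * (M * F + b * ((R + \<epsilon>) * F))"
      by (simp add: gap_def algebra_simps)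
    finally show ?case using elim(1) by simp
  qed
  then show False by simp
qed

lemma min_scale: "c > 0 \<Longrightarrow> real (min (c * x) y) / real c = min (real x) (real y / real c)"
  by (simp add: min_def field_simps flip: of_nat_mult)

theorem lemma4:
  fixes L K l s b :: nat and N U d :: "nat \<Rightarrow> nat" and M :: real and A :: "nat set"
  assumes "L \<ge> 1" and "K \<ge> 1"
    and "\<forall>i\<in>{1..L}. N i \<ge> 1 \<and> U i \<ge> 1 \<and> d i \<ge> 1 \<and> d i \<le> K"
    and "\<forall>i\<in>{1..L}. N i \<ge> K * U i"
    and "M \<ge> 0"
    and "A \<subseteq> {1..L}" and "l \<in> {1..L}" and "l \<notin> A"
    and "s \<in> {d l..K}" and "b \<ge> 1"
  shows "optimal_rate L K N U d M \<ge>
    1 / (real (Max (d ` {1..L})) + 1) *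
      min ((real s - real (d l) + 1) * real (U l)) (real (N l) / (real s * real b)) +
    (\<Sum>j\<in>A. min (real (U j)) (real (N j) / (real b * real (d j)))) -
    M / real b"
  unfolding optimal_rate_def
proof (rule cInf_greatest)
  show "{R. 0 \<le> R \<and> achievable L K N U d R M} \<noteq> {}"
    using achievable_broadcast_all[of L K N U d M] of_nat_0_le_iff by blast
next
  fix R assume "R \<in> {R. 0 \<le> R \<and> achievable L K N U d R M}"
  then have ach: "achievable L K N U d R M" by simp
  let ?S = "\<lambda>j t k. window_deliveries K b (U j) (d j) t k"
  let ?ml = "min ((real s - real (d l) + 1) * real (U l)) (real (N l) / (real s * real b))"
  let ?mA = "\<lambda>j. min (real (U j)) (real (N j) / (real b * real (d j)))"
  define t where "t j = (if j = l then s else d j)" for j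
  have lev: "1 \<le> N i" "1 \<le> d i" "d i \<le> K" if "i \<in> {1..L}" for i using assms(3) that by auto
  have dl: "1 \<le> d l" "d l \<le> s" "s \<le> K" using lev[OF assms(7)] assms(9) by auto
  have lower: "\<exists>g\<in>deliveries K b (U j) \<rightarrow> {..<N j}.
      K * b * (if j = l then ?ml / 2 else ?mA j) \<le> (\<Sum>k<K. real (card (g ` ?S j (t j) k))) / t j"
    if "j \<in> insert l A" for j
  proof (cases "j = l")
    case True
    \<comment> \<open>Windows of length \<open>s\<close> may share deliveries, hence the averaged
      assignment. Each window contains \<open>s * b * (s - d l + 1) * U l\<close>
      deliveries.\<close>
    obtain g where g: "g \<in> deliveries K b (U l) \<rightarrow> {..<N l}"
      "K * (real (min (s * b * (s - d l + 1) * U l) (N l)) / 2) \<le> (\<Sum>k<K. real (card (g ` ?S l s k)))"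
      using exists_covering_assignment[OF finite_deliveries lev(1)[OF assms(7)], of "{..<K}" "?S l s"
          K b "U l" "s * b * (s - d l + 1) * U l"]
        window_deliveries_subset[OF assms(2)] card_window_deliveries[OF dl] by auto
    have "real (min ((s * b) * ((s - d l + 1) * U l)) (N l)) / real (s * b) =
        min (real ((s - d l + 1) * U l)) (real (N l) / real (s * b))"
      using dl assms(10) by (intro min_scale) simp
    also have "real ((s - d l + 1) * U l) = real (s - d l + 1) * real (U l)" by (rule of_nat_mult)
    also have "\<dots> = (real s - real (d l) + 1) * real (U l)"
      using dl by (simp add: of_nat_diff distrib_right)
    finally have "real (min (s * b * (s - d l + 1) * U l) (N l)) = s * b * ?ml"
      using dl assms(10) by (simp add: field_simps mult.assoc)
    then have "K * b * (?ml / 2) \<le> (\<Sum>k<K. real (card (g ` ?S l s k))) / s"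
      using g(2) dl by (simp add: field_simps)
    then show ?thesis using True g(1) by (auto simp: t_def)
  next
    case False
    then have j: "j \<in> {1..L}" using that assms(6) by auto
    note dj = lev[OF j]
    \<comment> \<open>At length \<open>d j\<close> the window at \<open>k\<close> keeps only users
      at position \<open>k\<close>, so different windows involve different users.\<close>
    have "disjoint_family_on (?S j (d j)) {..<K}"
      unfolding disjoint_family_on_def window_deliveries_def using dj
      by (auto simp: window_1 simp flip: One_nat_def)
    then obtain g where g: "g \<in> UNIV \<rightarrow> {..<N j}"
      "\<forall>k<K. card (g ` ?S j (d j) k) = min (d j * b * U j) (N j)"
      using exists_exact_covering_assignment[OF dj(1), of "{..<K}" "?S j (d j)" "d j * b * U j"]
        card_window_deliveries[OF dj(2) order_refl dj(3), of b "U j"] finite_window_deliveries by auto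
    have "real (min ((b * d j) * U j) (N j)) / real (b * d j) =
        min (real (U j)) (real (N j) / real (b * d j))"
      using dj assms(10) by (intro min_scale) simp
    then have "real (min (d j * b * U j) (N j)) = b * d j * ?mA j"
      using dj assms(10) by (simp add: field_simps)
    then have "K * b * ?mA j \<le> (\<Sum>k<K. real (card (g ` ?S j (d j) k))) / d j"
      using g(2) dj by (simp add: field_simps)
    then show ?thesis using False g(1) by (auto simp: t_def)
  qed
  then obtain f where f: "\<And>j. j \<in> insert l A \<Longrightarrow> f j \<in> deliveries K b (U j) \<rightarrow> {..<N j} \<and>
      K * b * (if j = l then ?ml / 2 else ?mA j) \<le> (\<Sum>k<K. real (card (f j ` ?S j (t j) k))) / t j"
    by metis
  have fin: "finite A" using assms(6) finite_subset by blast
  have "K * b * (?ml / 2 + (\<Sum>j\<in>A. ?mA j)) = (\<Sum>j\<in>insert l A. K * b * (if j = l then ?ml / 2 else ?mA j))"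
    using fin assms(8) by (auto simp: distrib_left sum_distrib_left intro!: sum.cong)
  also have "\<dots> \<le> (\<Sum>j\<in>insert l A. (\<Sum>k<K. real (card (f j ` ?S j (t j) k))) / t j)"
    using f by (intro sum_mono) blast
  also have "\<dots> \<le> K * (M + b * R)"
  proof (rule achievable_cut_set[OF ach assms(2,10,5)])
    show "1 \<le> d j \<and> d j \<le> t j \<and> t j \<le> K" if "j \<in> insert l A" for j
      using lev[of j] that dl assms(6,7) by (auto simp: t_def)
  qed (use lev(1) f assms(6,7) in blast)+
  finally have "K * (b * (?ml / 2 + (\<Sum>j\<in>A. ?mA j))) \<le> K * (M + b * R)" by simp
  then have "b * (?ml / 2 + (\<Sum>j\<in>A. ?mA j)) \<le> M + b * R" using assms(2) by simp
  then have *: "?ml / 2 + (\<Sum>j\<in>A. ?mA j) - M / b \<le> R" using assms(10) by (simp add: field_simps)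
  \<comment> \<open>The factor 1/2 from the averaged requests is weakened to
    \<open>1 / (D + 1)\<close>, which needs \<open>D \<ge> 1\<close> and a nonnegative
    minimum.\<close>
  have "1 \<le> Max (d ` {1..L})"
    using dl(1) assms(7) by (intro order_trans[OF dl(1)] Max_ge) auto
  moreover have "?ml \<ge> 0" using dl by simp
  ultimately have "1 / (real (Max (d ` {1..L})) + 1) * ?ml \<le> 1 / 2 * ?ml"
    by (intro mult_right_mono) (simp_all add: field_simps)
  then have "1 / (real (Max (d ` {1..L})) + 1) * ?ml \<le> ?ml / 2" by simp
  from order_trans[OF diff_right_mono[OF add_right_mono[OF this]] *]
  show "1 / (real (Max (d ` {1..L})) + 1) * ?ml + (\<Sum>j\<in>A. ?mA j) - M / real b \<le> R" .
qed

end
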